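(* Let $X$ be a Banach space with the Pelczynski property. Then $X\notin TNNS$, that is, $X^{*}$ contains no total nowhere norming subspace.
   Context: "Subspace" means closed linear subspace. Let $X$ be a Banach space with dual $X^{*}$. A subspace $M\subset X^{*}$ is total if for every $0\neq x\in X$ there is $f\in M$ with $f(x)\neq 0$. A subspace $M\subset X^{*}$ is norming over a subspace $L\subset X$ if there is $c>0$ such that $\sup_{f\in S(M)}|f(x)|\ge c\|x\|$ for all $x\in L$, where $S(M)$ is the unit sphere of $M$. A subspace $M\subset X^{*}$ is nowhere norming if there is no infinite-dimensional subspace $L\subset X$ over which $M$ is norming. One writes $X\in TNNS$ if $X^{*}$ contains a total nowhere norming subspace. $X$ has the Pelczynski property if for every subset $K\subset X^{*}$ that is not relatively weakly compact there exists a weakly unconditionally convergent series $\sum_{n=1}^{\infty}x_{n}$ in $X$ (i.e. $\sum_{n}|x^{*}(x_{n})|<\infty$ for every $x^{*}\in X^{*}$) such that $\inf_{n}\sup_{x^{*}\in K}x^{*}(x_{n})>0$.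
   Formalization: X is assumed infinite-dimensional: every finite-dimensional X has the Pelczynski property, yet X* itself is total and vacuously nowhere norming, so X would be in TNNS. *)

theory Defs
  imports "HOL-Analysis.Analysis"
begin

text \<open>
  Banach spaces are real and are represented by types of class \<^class>\<open>banach\<close>; the dual of
  \<open>'a\<close> is the type \<open>'a \<Rightarrow>\<^sub>L real\<close> with the operator norm.
\<close>

definition closed_subspace :: "'a::real_normed_vector set \<Rightarrow> bool" where
  "closed_subspace L \<longleftrightarrow> subspace L \<and> closed L"

text \<open>
  The library constant \<open>dim\<close> is \<open>0\<close> on infinite-dimensional spaces, so it cannot be
  used to express infinite dimension.
\<close>

definition infinite_dimensional :: "'a::real_vector set \<Rightarrow> bool" where
  "infinite_dimensional L \<longleftrightarrow> (\<nexists>B. finite B \<and> span B = L)"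

definition total_set :: "('a::real_normed_vector \<Rightarrow>\<^sub>L real) set \<Rightarrow> bool" where
  "total_set M \<longleftrightarrow> (\<forall>x. x \<noteq> 0 \<longrightarrow> (\<exists>f\<in>M. f x \<noteq> 0))"

text \<open>
  Suprema and infima are taken in \<^typ>\<open>ereal\<close>: there they exist also for empty and
  unbounded families, where the real-valued ones are unspecified.
\<close>

definition norming_over :: "('a::real_normed_vector \<Rightarrow>\<^sub>L real) set \<Rightarrow> 'a set \<Rightarrow> bool" where
  "norming_over M L \<longleftrightarrow>
     (\<exists>c>0. \<forall>x\<in>L. (SUP f\<in>{f\<in>M. norm f = 1}. ereal \<bar>blinfun_apply f x\<bar>) \<ge> ereal (c * norm x))"

definition nowhere_norming :: "('a::real_normed_vector \<Rightarrow>\<^sub>L real) set \<Rightarrow> bool" where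
  "nowhere_norming M \<longleftrightarrow>
     (\<nexists>L. closed_subspace L \<and> infinite_dimensional L \<and> norming_over M L)"

text \<open>
  Every finite-dimensional space is TNNS (take the whole dual) and also has the Pelczynski
  property below, so statements relating the two need an infinite-dimensional space.
\<close>

definition TNNS :: "'a::banach itself \<Rightarrow> bool" where
  "TNNS _ \<longleftrightarrow>
     (\<exists>M :: ('a \<Rightarrow>\<^sub>L real) set. closed_subspace M \<and> total_set M \<and> nowhere_norming M)"

definition weak_topology :: "'b::real_normed_vector topology" where
  "weak_topology = topology_generated_by {{y. blinfun_apply \<phi> y \<in> U} | (\<phi> :: 'b \<Rightarrow>\<^sub>L real) U. open U}"

definition relatively_weakly_compact :: "'b::real_normed_vector set \<Rightarrow> bool" where
  "relatively_weakly_compact K \<longleftrightarrow> compactin weak_topology (weak_topology closure_of K)"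

definition weakly_unconditionally_convergent :: "(nat \<Rightarrow> 'a::real_normed_vector) \<Rightarrow> bool" where
  "weakly_unconditionally_convergent x \<longleftrightarrow> (\<forall>f :: 'a \<Rightarrow>\<^sub>L real. summable (\<lambda>n. \<bar>f (x n)\<bar>))"

text \<open>
  Below, \<^const>\<open>relatively_weakly_compact\<close> is used at the dual space as \<open>'b\<close>, i.e.\ for the
  topology induced on the dual by the bidual, not for the weak-star topology.
\<close>

definition Pelczynski_property :: "'a::banach itself \<Rightarrow> bool" where
  "Pelczynski_property _ \<longleftrightarrow>
     (\<forall>K :: ('a \<Rightarrow>\<^sub>L real) set. \<not> relatively_weakly_compact K \<longrightarrow>
        (\<exists>x :: nat \<Rightarrow> 'a. weakly_unconditionally_convergent x \<and>
           (INF n. SUP f\<in>K. ereal (blinfun_apply f (x n))) > 0))"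

end

theory Submission
  imports Defs
begin

text \<open>
  Let \<open>M\<close> be a total closed subspace of the dual of an infinite-dimensional space \<open>X\<close> with the
  Pelczynski property. It has to be shown that \<open>M\<close> is norming over some infinite-dimensional closed
  subspace of \<open>X\<close>. The argument depends on whether the unit ball of \<open>M\<close> is relatively weakly compact.

  If it is not, the Pelczynski property gives a weakly unconditionally convergent series \<open>x\<close> and
  functionals \<open>f n\<close> in the ball of \<open>M\<close> with \<open>\<delta> < f n (x n)\<close> for one \<open>\<delta> > 0\<close>. Rosenthal's lemma
  (\<open>Rosenthal_disjointification\<close>) thins out the indices until the two systems are almost
  biorthogonal. Along the remaining indices the \<open>x n\<close> behave like the unit vectors of \<open>c\<^sub>0\<close>, and the
  functionals \<open>f n\<close> read off the coefficients, so that \<open>M\<close> is norming over the closed span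
  (\<open>norming_over_some_of_wuc\<close>).

  If it is, then \<open>M\<close> is norming over all of \<open>X\<close>. Indeed a minimax argument on the weakly compact
  ball shows that a vector on which the ball of \<open>M\<close> is bounded by \<open>1\<close> can be approximated, in the
  norm given by \<open>M\<close>, by vectors from the unit ball of \<open>X\<close> (\<open>approximate_by_unit_ball\<close>). Summing up
  successive approximations, and using that \<open>M\<close> is total to identify the limit, bounds the norm of
  the vector by \<open>2\<close> (\<open>norm_le_of_compact_ball\<close>).

  Both cases use the Hahn-Banach theorem, which is derived from the fact that minimal sublinear
  functionals are linear.
\<close>

section \<open>Linear functionals below sublinear ones\<close>

definition sublinear :: "('a::real_vector \<Rightarrow> real) \<Rightarrow> bool" where
  "sublinear p \<longleftrightarrow> (\<forall>x y. p (x + y) \<le> p x + p y) \<and> (\<forall>c\<ge>0. \<forall>x. p (c *\<^sub>R x) = c * p x)"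

lemma sublinear_zero: "sublinear p \<Longrightarrow> p 0 = 0"
  unfolding sublinear_def by (metis mult_zero_left order_refl scaleR_zero_left)

lemma sublinear_neg_le: "sublinear p \<Longrightarrow> - p (- x) \<le> p x"
  using sublinear_zero[of p] unfolding sublinear_def
  by (metis add.right_inverse diff_ge_0_iff_ge diff_minus_eq_add)

text \<open>
  Lowering \<open>p\<close> along the ray through \<open>y\<close> is what makes minimality strong: if \<open>p\<close> is minimal among
  sublinear functionals, then \<open>q = p\<close>, and the last inequality turns subadditivity into additivity.
  It is also how a functional is made to attain a prescribed value of \<open>p\<close>. The witness is
  \<open>q x = inf {p (x + t y) - t p y | t \<ge> 0}\<close>.
\<close>

lemma sublinear_decrease:
  fixes p :: "'a::real_vector \<Rightarrow> real"
  assumes p: "sublinear p"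
  obtains q where "sublinear q" "q \<le> p" "\<And>x. q x \<le> p (x + y) - p y"
proof -
  define h where "h x t = p (x + t *\<^sub>R y) - t * p y" for x t
  define q where "q x = (INF t\<in>{0..}. h x t)" for x
  have sub: "p (a + b) \<le> p a + p b" for a b
    using p unfolding sublinear_def by blast
  have hom: "0 \<le> c \<Longrightarrow> p (c *\<^sub>R a) = c * p a" for a c
    using p unfolding sublinear_def by blast
  have lower: "- p (- x) \<le> h x t" if "0 \<le> t" for x t
    using sub[of "x + t *\<^sub>R y" "- x"] hom[OF that, of y] unfolding h_def by simp
  have q_le: "q x \<le> h x t" if "0 \<le> t" for x t
    unfolding q_def using that lower by (intro cINF_lower bdd_belowI2[where m = "- p (- x)"]) auto
  have q_ge: "a \<le> q x" if "\<And>t. 0 \<le> t \<Longrightarrow> a \<le> h x t" for a x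
    unfolding q_def using that by (intro cINF_greatest) auto
  have q_hom_le: "q (c *\<^sub>R x) \<le> c * q x" if "0 < c" for c x
  proof -
    have "q (c *\<^sub>R x) / c \<le> h x t" if "0 \<le> t" for t
    proof -
      have "q (c *\<^sub>R x) \<le> h (c *\<^sub>R x) (c * t)"
        using that \<open>0 < c\<close> by (intro q_le) simp
      also have "\<dots> = c * h x t"
        using hom[of c "x + t *\<^sub>R y"] \<open>0 < c\<close> unfolding h_def by (simp add: algebra_simps)
      finally show ?thesis
        using \<open>0 < c\<close> by (simp add: field_simps)
    qed
    then have "q (c *\<^sub>R x) / c \<le> q x"
      by (rule q_ge)
    then show ?thesis
      using that by (simp add: field_simps)
  qed
  have "sublinear q"
    unfolding sublinear_def
  proof (intro conjI allI impI)
    fix x x'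
    have "q (x + x') - h x t \<le> q x'" if "0 \<le> t" for t
    proof (rule q_ge)
      fix s :: real assume "0 \<le> s"
      have "q (x + x') \<le> h (x + x') (t + s)"
        using that \<open>0 \<le> s\<close> by (intro q_le) simp
      also have "\<dots> \<le> h x t + h x' s"
        using sub[of "x + t *\<^sub>R y" "x' + s *\<^sub>R y"] unfolding h_def by (simp add: algebra_simps)
      finally show "q (x + x') - h x t \<le> h x' s" by simp
    qed
    then have "q (x + x') - q x' \<le> q x"
      by (intro q_ge) (simp add: algebra_simps)
    then show "q (x + x') \<le> q x + q x'" by simp
  next
    fix c :: real and x assume "0 \<le> c"
    show "q (c *\<^sub>R x) = c * q x"
    proof (cases "c = 0")
      case True
      have "h 0 t = 0" if "0 \<le> t" for t
        using hom[OF that] unfolding h_def by simp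
      then have "q 0 = 0"
        using q_le[of 0 0] q_ge[of 0 0] by force
      with True show ?thesis by simp
    next
      case False
      with \<open>0 \<le> c\<close> have "0 < c" by simp
      then have "q (inverse c *\<^sub>R c *\<^sub>R x) \<le> inverse c * q (c *\<^sub>R x)"
        by (intro q_hom_le) simp
      with \<open>0 < c\<close> q_hom_le[OF \<open>0 < c\<close>, of x] show ?thesis
        by (simp add: field_simps)
    qed
  qed
  moreover have "q \<le> p"
    using q_le[of 0] unfolding h_def le_fun_def by simp
  moreover have "q x \<le> p (x + y) - p y" for x
    using q_le[of 1 x] unfolding h_def by simp
  ultimately show thesis by (rule that)
qed

lemma minimal_sublinear_linear:
  assumes m: "sublinear m" and minimal: "\<And>q. sublinear q \<Longrightarrow> q \<le> m \<Longrightarrow> q = m"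
  shows "linear m"
proof -
  have sub: "m (a + b) \<le> m a + m b" for a b
    using m unfolding sublinear_def by blast
  have add: "m (x + y) = m x + m y" for x y
  proof -
    obtain q where "sublinear q" "q \<le> m" "\<And>x. q x \<le> m (x + y) - m y"
      using sublinear_decrease[OF m] by blast
    then have "m x \<le> m (x + y) - m y"
      using minimal by blast
    with sub[of x y] show ?thesis by simp
  qed
  have neg: "m (- x) = - m x" for x
    using add[of x "- x"] sublinear_zero[OF m] by simp
  have "m (c *\<^sub>R x) = c * m x" for c x
  proof (cases "0 \<le> c")
    case True
    with m show ?thesis unfolding sublinear_def by blast
  next
    case False
    then have "m ((- c) *\<^sub>R x) = - c * m x"
      using m unfolding sublinear_def by (metis linorder_le_cases neg_0_le_iff_le)
    then show ?thesis using neg[of "c *\<^sub>R x"] by simp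
  qed
  with add show ?thesis by (intro linearI) auto
qed

lemma minimal_sublinear_exists:
  fixes p :: "'a::real_vector \<Rightarrow> real"
  assumes p: "sublinear p"
  obtains m where "sublinear m" "m \<le> p" "\<And>q. sublinear q \<Longrightarrow> q \<le> m \<Longrightarrow> q = m"
proof -
  let ?A = "{q. sublinear q \<and> q \<le> p}"
  let ?R = "relation_of (\<lambda>a b :: 'a \<Rightarrow> real. b \<le> a) ?A"
  have "\<exists>m\<in>?A. \<forall>a\<in>?A. a \<le> m \<longrightarrow> a = m"
  proof (rule predicate_Zorn)
    show "partial_order_on ?A ?R"
      by (auto simp: partial_order_on_def preorder_on_def relation_of_def refl_on_def trans_def antisym_def)
  next
    fix C assume C: "C \<in> Chains ?R"
    have chain: "a \<le> b \<or> b \<le> a" if "a \<in> C" "b \<in> C" for a b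
      using C that unfolding Chains_def relation_of_def by blast
    have CA: "a \<in> ?A" if "a \<in> C" for a
      using C that unfolding Chains_def relation_of_def by blast
    show "\<exists>u\<in>?A. \<forall>a\<in>C. u \<le> a"
    proof (cases "C = {}")
      case True
      with p show ?thesis by auto
    next
      case False
      define u where "u x = (INF a\<in>C. a x)" for x
      have lower: "- p (- x) \<le> a x" if "a \<in> C" for a x
        using sublinear_neg_le[of a x] CA[OF that] by (force simp: le_fun_def dest: spec[of _ "- x"])
      have u_le: "u x \<le> a x" if "a \<in> C" for a x
        unfolding u_def using that lower by (intro cINF_lower bdd_belowI2[where m = "- p (- x)"]) auto
      have u_ge: "b \<le> u x" if "\<And>a. a \<in> C \<Longrightarrow> b \<le> a x" for b x
        unfolding u_def using that False by (intro cINF_greatest) auto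
      have sub: "a (x + y) \<le> a x + a y" if "a \<in> C" for a x y
        using CA[OF that] unfolding sublinear_def by blast
      have hom: "a (c *\<^sub>R x) = c * a x" if "a \<in> C" "0 \<le> c" for a c x
        using CA[OF that(1)] that(2) unfolding sublinear_def by blast
      have hom_le: "u (c *\<^sub>R x) \<le> c * u x" if "0 < c" for c x
      proof -
        have "u (c *\<^sub>R x) / c \<le> u x"
        proof (rule u_ge)
          fix a assume "a \<in> C"
          then show "u (c *\<^sub>R x) / c \<le> a x"
            using u_le[of a "c *\<^sub>R x"] hom[of a c x] that by (simp add: field_simps)
        qed
        with that show ?thesis by (simp add: field_simps)
      qed
      have "sublinear u"
        unfolding sublinear_def
      proof (intro conjI allI impI)
        fix x y
        have "u (x + y) - a x \<le> u y" if "a \<in> C" for a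
        proof (rule u_ge)
          fix b assume "b \<in> C"
          have "u (x + y) \<le> a x + b y"
          proof (cases "a \<le> b")
            case True
            then show ?thesis
              using u_le[OF \<open>a \<in> C\<close>, of "x + y"] sub[OF \<open>a \<in> C\<close>, of x y] by (simp add: le_fun_def) (smt (verit))
          next
            case False
            with chain[OF \<open>a \<in> C\<close> \<open>b \<in> C\<close>] show ?thesis
              using u_le[OF \<open>b \<in> C\<close>, of "x + y"] sub[OF \<open>b \<in> C\<close>, of x y] by (simp add: le_fun_def) (smt (verit))
          qed
          then show "u (x + y) - a x \<le> b y" by simp
        qed
        then have "u (x + y) - u y \<le> u x"
          by (intro u_ge) (simp add: algebra_simps)
        then show "u (x + y) \<le> u x + u y" by simp
      next
        fix c :: real and x assume "0 \<le> c"
        show "u (c *\<^sub>R x) = c * u x"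
        proof (cases "c = 0")
          case True
          have "a 0 = 0" if "a \<in> C" for a
            using CA[OF that] sublinear_zero by blast
          then have "u 0 = 0"
            using u_le[of _ 0] u_ge[of 0 0] False by force
          with True show ?thesis by simp
        next
          case False
          with \<open>0 \<le> c\<close> have "0 < c" by simp
          then have "u (inverse c *\<^sub>R c *\<^sub>R x) \<le> inverse c * u (c *\<^sub>R x)"
            by (intro hom_le) simp
          with \<open>0 < c\<close> hom_le[OF \<open>0 < c\<close>, of x] show ?thesis
            by (simp add: field_simps)
        qed
      qed
      moreover have "u \<le> p"
        using False CA u_le unfolding le_fun_def by (metis (mono_tags, lifting) all_not_in_conv le_fun_def mem_Collect_eq order_trans)
      moreover have "\<forall>a\<in>C. u \<le> a"
        using u_le unfolding le_fun_def by blast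
      ultimately show ?thesis by blast
    qed
  qed
  then obtain m where m: "sublinear m" "m \<le> p" "\<forall>a\<in>?A. a \<le> m \<longrightarrow> a = m"
    by blast
  show thesis
  proof (rule that[OF m(1,2)])
    fix q assume "sublinear q" "q \<le> m"
    with m show "q = m" using order_trans[of q m p] by blast
  qed
qed

text \<open>
  Any minimal sublinear functional below \<open>p\<close> is linear. To reach the value \<open>p x0\<close> at \<open>x0\<close>,
  \<open>p\<close> is first lowered along \<open>x0\<close>, which forces the value at \<open>- x0\<close> down to \<open>- p x0\<close>.
\<close>

theorem Hahn_Banach:
  fixes p :: "'a::real_vector \<Rightarrow> real"
  assumes p: "sublinear p"
  obtains g where "linear g" "\<And>x. g x \<le> p x" "g x0 = p x0"
proof -
  obtain q where q: "sublinear q" "q \<le> p" "\<And>x. q x \<le> p (x + x0) - p x0"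
    using sublinear_decrease[OF p] by blast
  obtain g where g: "sublinear g" "g \<le> q" "\<And>r. sublinear r \<Longrightarrow> r \<le> g \<Longrightarrow> r = g"
    using minimal_sublinear_exists[OF q(1)] by blast
  have lin: "linear g"
    using minimal_sublinear_linear g(1,3) by blast
  have le: "g x \<le> p x" for x
    using g(2) q(2) unfolding le_fun_def by (meson order_trans)
  have "g (- x0) \<le> p (- x0 + x0) - p x0"
    using g(2) q(3)[of "- x0"] unfolding le_fun_def by (meson order_trans)
  then have "p x0 \<le> g x0"
    using linear_neg[OF lin, of x0] sublinear_zero[OF p] by simp
  with le[of x0] have "g x0 = p x0" by simp
  with lin le show thesis by (rule that)
qed

lemma Hahn_Banach_bounded:
  fixes p :: "'a::real_normed_vector \<Rightarrow> real"
  assumes p: "sublinear p" and bound: "\<And>x. p x \<le> norm x"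
  obtains g :: "'a \<Rightarrow>\<^sub>L real" where "norm g \<le> 1" "\<And>x. g x \<le> p x" "g x0 = p x0"
proof -
  obtain g where g: "linear g" "\<And>x. g x \<le> p x" "g x0 = p x0"
    using Hahn_Banach[OF p] by blast
  have abs: "\<bar>g x\<bar> \<le> norm x" for x
    using g(2)[of x] g(2)[of "- x"] bound[of x] bound[of "- x"] linear_neg[OF g(1), of x] by simp
  have bl: "bounded_linear g"
    using g(1) abs unfolding bounded_linear_def bounded_linear_axioms_def
    by (intro conjI exI[of _ 1]) auto
  show thesis
  proof (rule that[of "Blinfun g"])
    show "norm (Blinfun g) \<le> 1"
      using abs by (intro norm_blinfun_bound) (auto simp: bounded_linear_Blinfun_apply[OF bl])
  qed (use g bounded_linear_Blinfun_apply[OF bl] in auto)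
qed

lemma norming_functional:
  fixes x :: "'a::real_normed_vector"
  obtains g :: "'a \<Rightarrow>\<^sub>L real" where "norm g \<le> 1" "g x = norm x"
proof -
  have "sublinear (norm :: 'a \<Rightarrow> real)"
    unfolding sublinear_def by (simp add: norm_triangle_ineq)
  then obtain g :: "'a \<Rightarrow>\<^sub>L real" where "norm g \<le> 1" "g x = norm x"
    using Hahn_Banach_bounded[of norm x] by auto
  then show thesis by (rule that)
qed

text \<open>
  The distance to \<open>M\<close> is sublinear and vanishes exactly on \<open>M\<close>; a linear functional below it that
  attains it at \<open>h\<close> therefore separates.
\<close>

lemma separate_point_closed_subspace:
  fixes M :: "'a::real_normed_vector set"
  assumes M: "closed_subspace M" and h: "h \<notin> M"
  obtains g :: "'a \<Rightarrow>\<^sub>L real" where "\<And>f. f \<in> M \<Longrightarrow> g f = 0" "g h \<noteq> 0"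
proof -
  have sM: "subspace M" and cM: "closed M"
    using M unfolding closed_subspace_def by auto
  have ne: "M \<noteq> {}"
    using subspace_0[OF sM] by blast
  have le: "infdist x M \<le> norm (x - m)" if "m \<in> M" for x m
    using infdist_le[OF that, of x] by (simp add: dist_norm)
  have ge: "a \<le> infdist x M" if "\<And>m. m \<in> M \<Longrightarrow> a \<le> norm (x - m)" for a x
    using that ne by (auto simp: infdist_notempty dist_norm intro!: cINF_greatest)
  have hom_le: "infdist (c *\<^sub>R x) M \<le> c * infdist x M" if "0 < c" for c x
  proof -
    have "infdist (c *\<^sub>R x) M / c \<le> infdist x M"
    proof (rule ge)
      fix m assume "m \<in> M"
      then have "infdist (c *\<^sub>R x) M \<le> norm (c *\<^sub>R x - c *\<^sub>R m)"
        by (intro le subspace_scale[OF sM])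
      also have "\<dots> = c * norm (x - m)"
        using that by (simp flip: scaleR_diff_right)
      finally show "infdist (c *\<^sub>R x) M / c \<le> norm (x - m)"
        using that by (simp add: field_simps)
    qed
    with that show ?thesis by (simp add: field_simps)
  qed
  have "sublinear (\<lambda>x. infdist x M)"
    unfolding sublinear_def
  proof (intro conjI allI impI)
    fix x y
    have "infdist (x + y) M - norm (x - m) \<le> infdist y M" if "m \<in> M" for m
    proof (rule ge)
      fix m' assume "m' \<in> M"
      with that have "infdist (x + y) M \<le> norm (x + y - (m + m'))"
        by (intro le subspace_add[OF sM])
      also have "\<dots> = norm ((x - m) + (y - m'))"
        by (simp add: algebra_simps)
      also have "\<dots> \<le> norm (x - m) + norm (y - m')"
        by (rule norm_triangle_ineq)
      finally show "infdist (x + y) M - norm (x - m) \<le> norm (y - m')" by simp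
    qed
    then have "infdist (x + y) M - infdist y M \<le> infdist x M"
      by (intro ge) (simp add: algebra_simps)
    then show "infdist (x + y) M \<le> infdist x M + infdist y M" by simp
  next
    fix c :: real and x assume "0 \<le> c"
    show "infdist (c *\<^sub>R x) M = c * infdist x M"
    proof (cases "c = 0")
      case True
      with subspace_0[OF sM] show ?thesis by simp
    next
      case False
      with \<open>0 \<le> c\<close> have "0 < c" by simp
      then have "infdist (inverse c *\<^sub>R c *\<^sub>R x) M \<le> inverse c * infdist (c *\<^sub>R x) M"
        by (intro hom_le) simp
      with \<open>0 < c\<close> hom_le[OF \<open>0 < c\<close>, of x] show ?thesis
        by (simp add: field_simps)
    qed
  qed
  moreover have "infdist x M \<le> norm x" for x
    using le[OF subspace_0[OF sM], of x] by simp
  ultimately obtain g :: "'a \<Rightarrow>\<^sub>L real"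
    where g: "\<And>x. g x \<le> infdist x M" "g h = infdist h M"
    using Hahn_Banach_bounded[of "\<lambda>x. infdist x M" h] by blast
  show thesis
  proof (rule that)
    show "g f = 0" if "f \<in> M" for f
      using g(1)[of f] g(1)[of "- f"] that subspace_neg[OF sM that] by (simp add: blinfun.minus_right)
    show "g h \<noteq> 0"
      using g(2) h cM ne in_closed_iff_infdist_zero by metis
  qed
qed

section \<open>The weak topology of the dual\<close>

lemma topspace_weak_topology [simp]: "topspace weak_topology = UNIV"
  unfolding weak_topology_def topology_generated_by_topspace by auto

lemma continuous_map_weak_topology:
  fixes \<phi> :: "'b::real_normed_vector \<Rightarrow>\<^sub>L real"
  shows "continuous_map weak_topology euclideanreal (blinfun_apply \<phi>)"
  unfolding continuous_map_def
proof (intro conjI allI impI)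
  fix U :: "real set" assume "openin euclideanreal U"
  then show "openin weak_topology {y \<in> topspace weak_topology. \<phi> y \<in> U}"
    unfolding topspace_weak_topology unfolding weak_topology_def
    by (intro topology_generated_by_Basis) auto
qed auto

lemma continuous_map_weak_topology_eval:
  fixes x :: "'a::real_normed_vector"
  shows "continuous_map weak_topology euclideanreal (\<lambda>f :: 'a \<Rightarrow>\<^sub>L real. f x)"
proof -
  have bl: "bounded_linear (\<lambda>f :: 'a \<Rightarrow>\<^sub>L real. f x)"
    by (rule blinfun.bounded_linear_left)
  show ?thesis
    using continuous_map_weak_topology[of "Blinfun (\<lambda>f :: 'a \<Rightarrow>\<^sub>L real. f x)"]
    by (simp add: bounded_linear_Blinfun_apply[OF bl])
qed

lemma closedin_weak_preimage:
  fixes \<phi> :: "'b::real_normed_vector \<Rightarrow>\<^sub>L real"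
  assumes "closed S"
  shows "closedin weak_topology {y. \<phi> y \<in> S}"
  using closedin_continuous_map_preimage[OF continuous_map_weak_topology[of \<phi>], of S] assms by simp

lemma closedin_weak_eval_preimage:
  fixes x :: "'a::real_normed_vector"
  assumes "closed S"
  shows "closedin weak_topology {f :: 'a \<Rightarrow>\<^sub>L real. f x \<in> S}"
  using closedin_continuous_map_preimage[OF continuous_map_weak_topology_eval[of x], of S] assms by simp

lemma norm_blinfun_le_one_iff:
  fixes f :: "'a::real_normed_vector \<Rightarrow>\<^sub>L real"
  shows "norm f \<le> 1 \<longleftrightarrow> (\<forall>x. norm x \<le> 1 \<longrightarrow> \<bar>f x\<bar> \<le> 1)"
proof (intro iffI allI impI)
  fix x :: 'a assume "norm f \<le> 1" "norm x \<le> 1"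
  then show "\<bar>f x\<bar> \<le> 1"
    using norm_blinfun[of f x] mult_mono[of "norm f" 1 "norm x" 1] by simp
next
  assume *: "\<forall>x. norm x \<le> 1 \<longrightarrow> \<bar>f x\<bar> \<le> 1"
  show "norm f \<le> 1"
  proof (rule norm_blinfun_bound)
    fix x :: 'a
    show "norm (f x) \<le> 1 * norm x"
    proof (cases "x = 0")
      case False
      with *[rule_format, of "inverse (norm x) *\<^sub>R x"] show ?thesis
        by (simp add: blinfun.scaleR_right abs_mult field_simps)
    qed (simp add: blinfun.zero_right)
  qed simp
qed

text \<open>
  The ball is cut out by weakly closed conditions: the functionals on the dual that vanish on \<open>M\<close>
  detect membership in the closed subspace \<open>M\<close>, and evaluation at the unit ball of \<open>'a\<close> detects
  the norm bound. Hence a relatively weakly compact ball is weakly compact.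
\<close>

lemma closedin_weak_subspace_ball:
  fixes M :: "('a::real_normed_vector \<Rightarrow>\<^sub>L real) set"
  assumes M: "closed_subspace M"
  shows "closedin weak_topology {f \<in> M. norm f \<le> 1}"
proof -
  let ?ann = "{\<phi> :: ('a \<Rightarrow>\<^sub>L real) \<Rightarrow>\<^sub>L real. \<forall>f\<in>M. \<phi> f = 0}"
  have eq: "{f \<in> M. norm f \<le> 1} =
      (\<Inter>\<phi>\<in>?ann. {f. blinfun_apply \<phi> f \<in> {0}}) \<inter>
      (\<Inter>x\<in>cball 0 1. {f. blinfun_apply f x \<in> {-1..1}})"
  proof (intro set_eqI iffI)
    fix f assume "f \<in> {f \<in> M. norm f \<le> 1}"
    then show "f \<in> (\<Inter>\<phi>\<in>?ann. {f. blinfun_apply \<phi> f \<in> {0}}) \<inter>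
      (\<Inter>x\<in>cball 0 1. {f. blinfun_apply f x \<in> {-1..1}})"
      using norm_blinfun_le_one_iff[of f] by (auto simp: abs_le_iff minus_le_iff)
  next
    fix f assume f: "f \<in> (\<Inter>\<phi>\<in>?ann. {f. blinfun_apply \<phi> f \<in> {0}}) \<inter>
      (\<Inter>x\<in>cball 0 1. {f. blinfun_apply f x \<in> {-1..1}})"
    then have "norm f \<le> 1"
      unfolding norm_blinfun_le_one_iff by (auto simp: abs_le_iff minus_le_iff)
    moreover have "f \<in> M"
    proof (rule ccontr)
      assume "f \<notin> M"
      then obtain \<phi> :: "('a \<Rightarrow>\<^sub>L real) \<Rightarrow>\<^sub>L real" where "\<And>g. g \<in> M \<Longrightarrow> \<phi> g = 0" "\<phi> f \<noteq> 0"
        using separate_point_closed_subspace[OF M] by blast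
      with f show False by auto
    qed
    ultimately show "f \<in> {f \<in> M. norm f \<le> 1}" by simp
  qed
  show ?thesis
    unfolding eq
  proof (intro closedin_Int closedin_Inter)
    show "(\<lambda>\<phi>. {f. blinfun_apply \<phi> f \<in> {0}}) ` ?ann \<noteq> {}"
      by (auto intro!: exI[of _ 0])
  qed (auto intro!: closedin_weak_eval_preimage closedin_weak_preimage
      simp del: atLeastAtMost_iff insert_iff)
qed

lemma compactin_weak_subspace_ball:
  fixes M :: "('a::real_normed_vector \<Rightarrow>\<^sub>L real) set"
  assumes "closed_subspace M" "relatively_weakly_compact {f \<in> M. norm f \<le> 1}"
  shows "compactin weak_topology {f \<in> M. norm f \<le> 1}"
  using closedin_weak_subspace_ball[OF assms(1)] assms(2)
  unfolding relatively_weakly_compact_def by (simp add: closure_of_closedin)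

section \<open>A minimax argument on a weakly compact ball\<close>

lemma hinge_square_le: "(max 0 (a - t * b))\<^sup>2 \<le> (max 0 a - t * b)\<^sup>2" for a b t :: real
proof -
  have "\<bar>max 0 (a - t * b)\<bar> \<le> \<bar>max 0 a - t * b\<bar>" by linarith
  then show ?thesis unfolding abs_le_square_iff .
qed

text \<open>
  A minimax statement for finitely many points. If \<open>f\<close> minimises over \<open>K\<close> the total squared
  deficit of the inequalities \<open>\<epsilon> \<le> f (x0 - x)\<close>, the deficits \<open>w\<close> of \<open>f\<close>, normalised to sum \<open>1\<close>, are
  the weights of a convex combination \<open>z\<close> of the points. First-order optimality of \<open>f\<close> says that no
  member of \<open>K\<close> does better than \<open>f\<close> on the weighted sum, so all of \<open>K\<close> takes values at most
  \<open>\<epsilon>\<close> at \<open>x0 - z\<close>, contrary to the last assumption, unless all deficits vanish.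
\<close>

lemma finite_minimax:
  fixes K :: "('a::real_normed_vector \<Rightarrow>\<^sub>L real) set"
  assumes comp: "compactin weak_topology K" and conv: "convex K" and F: "finite F" "F \<subseteq> cball 0 1"
    and large: "\<And>z. norm z \<le> 1 \<Longrightarrow> \<exists>f\<in>K. \<epsilon> < f (x0 - z)"
  shows "\<exists>f\<in>K. \<forall>x\<in>F. \<epsilon> \<le> f (x0 - x)"
proof -
  define w where "w f x = max 0 (\<epsilon> - f (x0 - x))" for f :: "'a \<Rightarrow>\<^sub>L real" and x
  define \<Phi> where "\<Phi> f = (\<Sum>x\<in>F. (w f x)\<^sup>2)" for f
  have ne: "K \<noteq> {}"
    using large[of 0] by auto
  have "continuous_map weak_topology euclideanreal \<Phi>"
    unfolding \<Phi>_def w_def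
    by (intro continuous_map_sum F continuous_map_real_pow continuous_map_real_max
        continuous_map_diff continuous_map_weak_topology_eval continuous_map_const[THEN iffD2]) auto
  then have "compact (\<Phi> ` K)"
    using image_compactin[OF comp, of euclideanreal \<Phi>] by simp
  then obtain f where f: "f \<in> K" and min: "\<And>g. g \<in> K \<Longrightarrow> \<Phi> f \<le> \<Phi> g"
    using compact_attains_inf[of "\<Phi> ` K"] ne by auto
  define s where "s = (\<Sum>x\<in>F. w f x)"
  have w0: "0 \<le> w f x" for x
    unfolding w_def by simp
  have "s = 0"
  proof (rule ccontr)
    assume "s \<noteq> 0"
    then have s: "0 < s"
      unfolding s_def using w0 by (simp add: order_less_le sum_nonneg)
    define z where "z = (\<Sum>x\<in>F. (w f x / s) *\<^sub>R x)"
    have "norm z \<le> (\<Sum>x\<in>F. w f x / s)"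
      unfolding z_def using F(2) w0 s
      by (intro sum_norm_le) (auto simp: subset_iff intro!: divide_right_mono mult_left_le)
    also have "\<dots> = 1"
      using s by (simp add: s_def flip: sum_divide_distrib)
    finally obtain f' where f': "f' \<in> K" "\<epsilon> < f' (x0 - z)"
      using large by blast
    define b where "b x = f' (x0 - x) - f (x0 - x)" for x
    define A where "A = (\<Sum>x\<in>F. w f x * b x)"
    define B where "B = (\<Sum>x\<in>F. (b x)\<^sup>2)"
    have f'_z: "(\<Sum>x\<in>F. w f x * f' (x0 - x)) = s * f' (x0 - z)"
    proof -
      have "s * f' z = (\<Sum>x\<in>F. w f x * f' x)"
        using s by (simp add: z_def blinfun.sum_right blinfun.scaleR_right sum_distrib_left)
      moreover have "(\<Sum>x\<in>F. w f x * f' (x0 - x)) = s * f' x0 - (\<Sum>x\<in>F. w f x * f' x)"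
        unfolding s_def by (simp add: blinfun.diff_right right_diff_distrib sum_subtractf sum_distrib_right)
      ultimately show ?thesis
        by (simp add: blinfun.diff_right right_diff_distrib)
    qed
    have "(\<Sum>x\<in>F. w f x * f (x0 - x)) \<le> (\<Sum>x\<in>F. w f x * \<epsilon>)"
    proof (rule sum_mono)
      fix x
      show "w f x * f (x0 - x) \<le> w f x * \<epsilon>"
        by (cases "f (x0 - x) \<le> \<epsilon>") (auto simp: w_def intro!: mult_left_mono)
    qed
    also have "\<dots> = s * \<epsilon>"
      by (simp add: s_def sum_distrib_right)
    also have "\<dots> < s * f' (x0 - z)"
      using s f'(2) by simp
    finally have A: "0 < A"
      unfolding A_def b_def by (simp add: right_diff_distrib sum_subtractf f'_z)
    have B: "0 \<le> B"
      unfolding B_def by (simp add: sum_nonneg)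
    \<comment> \<open>A step from the minimiser towards the better competitor; its length makes the quadratic term smaller than the linear gain.\<close>
    define t where "t = min 1 (A / (B + 1))"
    have t: "0 < t" "t \<le> 1"
      using A B unfolding t_def by auto
    have tB: "t * B < 2 * A"
    proof -
      have "t * B \<le> A / (B + 1) * B"
        using B unfolding t_def by (intro mult_right_mono) auto
      also have "\<dots> \<le> A"
        using A B by (simp add: field_simps)
      finally show ?thesis using A by simp
    qed
    have "(1 - t) *\<^sub>R f + t *\<^sub>R f' \<in> K"
      using conv f f'(1) t by (intro convexD) auto
    then have "\<Phi> f \<le> \<Phi> ((1 - t) *\<^sub>R f + t *\<^sub>R f')"
      by (rule min)
    also have "\<dots> \<le> (\<Sum>x\<in>F. (w f x - t * b x)\<^sup>2)"
      unfolding \<Phi>_def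
    proof (rule sum_mono)
      fix x
      have "w ((1 - t) *\<^sub>R f + t *\<^sub>R f') x = max 0 ((\<epsilon> - f (x0 - x)) - t * b x)"
        unfolding w_def b_def
        by (simp add: blinfun.add_left blinfun.scaleR_left left_diff_distrib right_diff_distrib)
      then show "(w ((1 - t) *\<^sub>R f + t *\<^sub>R f') x)\<^sup>2 \<le> (w f x - t * b x)\<^sup>2"
        using hinge_square_le[of "\<epsilon> - f (x0 - x)" t "b x"] by (simp add: w_def)
    qed
    also have "\<dots> = \<Phi> f - t * (2 * A - t * B)"
      unfolding \<Phi>_def A_def B_def
      by (simp add: power2_eq_square algebra_simps sum.distrib sum_subtractf sum_distrib_left)
    finally have "t * (2 * A - t * B) \<le> 0" by simp
    with t tB show False
      by (simp add: mult_le_0_iff)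
  qed
  then have "w f x = 0" if "x \<in> F" for x
    using that w0 F(1) unfolding s_def by (simp add: sum_nonneg_eq_0_iff)
  then have "\<forall>x\<in>F. \<epsilon> \<le> f (x0 - x)"
    unfolding w_def by (metis diff_le_0_iff_le max.cobounded2)
  with f show ?thesis by blast
qed

text \<open>
  Measured by the ball of \<open>M\<close>, a point of size at most \<open>1\<close> is almost in the unit ball of the space.
  Otherwise the minimax lemma and compactness produce one \<open>f\<close> in the ball of \<open>M\<close> with
  \<open>f x + \<epsilon> \<le> f x0\<close> for every \<open>x\<close> of norm at most \<open>1\<close>, that is, \<open>norm f + \<epsilon> \<le> f x0\<close>,
  whereas \<open>f x0 \<le> norm f\<close> by assumption.
  This replaces the duality theory of the map from the space into the dual of \<open>M\<close>.
\<close>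

lemma approximate_by_unit_ball:
  fixes M :: "('a::real_normed_vector \<Rightarrow>\<^sub>L real) set"
  assumes M: "subspace M" and comp: "compactin weak_topology {f \<in> M. norm f \<le> 1}"
    and x0: "\<And>f. f \<in> M \<Longrightarrow> \<bar>blinfun_apply f x0\<bar> \<le> norm f" and \<epsilon>: "0 < \<epsilon>"
  shows "\<exists>x. norm x \<le> 1 \<and> (\<forall>f\<in>M. \<bar>blinfun_apply f (x0 - x)\<bar> \<le> \<epsilon> * norm f)"
proof (rule ccontr)
  let ?K = "{f \<in> M. norm f \<le> 1}"
  let ?C = "\<lambda>x. {f. (f :: 'a \<Rightarrow>\<^sub>L real) (x0 - x) \<in> {\<epsilon>..}}"
  assume no: "\<nexists>x. norm x \<le> 1 \<and> (\<forall>f\<in>M. \<bar>blinfun_apply f (x0 - x)\<bar> \<le> \<epsilon> * norm f)"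
  have large: "\<exists>f\<in>?K. \<epsilon> < f (x0 - z)" if "norm z \<le> 1" for z
  proof -
    from no that obtain f where f: "f \<in> M" "\<epsilon> * norm f < \<bar>f (x0 - z)\<bar>"
      by (meson not_le)
    then have "f \<noteq> 0" by auto
    define g where "g = (sgn (f (x0 - z)) / norm f) *\<^sub>R f"
    have "g \<in> M"
      unfolding g_def using f(1) M by (rule subspace_scale[rotated])
    moreover have "norm g \<le> 1"
      unfolding g_def by (simp add: abs_sgn_eq)
    moreover have "\<epsilon> < g (x0 - z)"
      using f(2) \<open>f \<noteq> 0\<close> unfolding g_def
      by (simp add: blinfun.scaleR_left field_simps abs_sgn)
    ultimately show ?thesis by blast
  qed
  have conv: "convex ?K"
    using subspace_imp_convex[OF M] convex_Int[of M "cball 0 1"] by (simp add: Int_def)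
  have fip: "?K \<inter> \<Inter>\<F> \<noteq> {}" if \<F>: "finite \<F>" "\<F> \<subseteq> ?C ` cball 0 1" for \<F>
  proof -
    obtain F where F: "finite F" "F \<subseteq> cball 0 1" "\<F> = ?C ` F"
      using finite_subset_image[OF \<F>] by blast
    then show ?thesis
      using finite_minimax[OF comp conv F(1,2) large] by auto
  qed
  have closed: "\<forall>C\<in>?C ` cball 0 1. closedin weak_topology C"
    using closedin_weak_eval_preimage[OF closed_atLeast] by blast
  have "?K \<inter> \<Inter>(?C ` cball 0 1) \<noteq> {}"
    using comp closed fip unfolding compactin_fip by blast
  then obtain f where "f \<in> ?K" "f \<in> \<Inter>(?C ` cball 0 1)"
    by blast
  then have f: "f \<in> M" "\<And>x. norm x \<le> 1 \<Longrightarrow> \<epsilon> \<le> f (x0 - x)"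
    by auto
  have "norm f \<le> f x0 - \<epsilon>"
  proof (rule norm_blinfun_bound)
    show "0 \<le> f x0 - \<epsilon>"
      using f(2)[of 0] by simp
    fix x
    show "norm (f x) \<le> (f x0 - \<epsilon>) * norm x"
    proof (cases "x = 0")
      case False
      with f(2)[of "inverse (norm x) *\<^sub>R x"] f(2)[of "- (inverse (norm x) *\<^sub>R x)"] show ?thesis
        by (simp add: blinfun.scaleR_right blinfun.diff_right blinfun.add_right field_simps abs_le_iff)
    qed (simp add: blinfun.zero_right)
  qed
  with x0[OF f(1)] \<epsilon> show False by simp
qed

section \<open>Norming over closures\<close>

text \<open>
  A nonzero \<open>f0\<close> in \<open>M\<close> is required because at \<open>x = 0\<close> the supremum over an empty unit sphere
  would be \<open>- \<infinity>\<close>. Halving \<open>c\<close> pays for approximating a point of the closure.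
\<close>

lemma norming_over_closure:
  fixes M :: "('a::real_normed_vector \<Rightarrow>\<^sub>L real) set"
  assumes M: "subspace M" and f0: "f0 \<in> M" "f0 \<noteq> 0" and c: "0 < c"
    and D: "\<And>x. x \<in> D \<Longrightarrow> \<exists>f\<in>M. norm f \<le> 1 \<and> c * norm x \<le> \<bar>blinfun_apply f x\<bar>"
  shows "norming_over M (closure D)"
  unfolding norming_over_def
proof (intro exI[of _ "c / 2"] conjI ballI)
  show "0 < c / 2" using c by simp
  fix x assume x: "x \<in> closure D"
  have "\<exists>g\<in>M. norm g = 1 \<and> c / 2 * norm x \<le> \<bar>blinfun_apply g x\<bar>"
  proof (cases "x = 0")
    case True
    with f0 show ?thesis
      by (intro bexI[of _ "sgn f0"]) (auto simp: norm_sgn sgn_div_norm intro: subspace_scale[OF M])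
  next
    case False
    define e where "e = c / 2 * norm x / (c + 1)"
    have e: "0 < e" "(c + 1) * e = c / 2 * norm x"
      using c False unfolding e_def by (auto simp: divide_simps)
    obtain d where d: "d \<in> D" "norm (x - d) < e"
      using x e(1) closure_approachable[of x D] by (auto simp: dist_norm norm_minus_commute)
    obtain f where f: "f \<in> M" "norm f \<le> 1" "c * norm d \<le> \<bar>f d\<bar>"
      using D[OF d(1)] by blast
    have "\<bar>f (x - d)\<bar> \<le> norm (x - d)"
      using norm_blinfun[of f "x - d"] mult_right_mono[OF f(2), of "norm (x - d)"] by simp
    moreover have "c * norm x \<le> c * norm d + c * norm (x - d)"
      using c norm_triangle_ineq[of d "x - d"] by (simp flip: distrib_left)
    moreover have "(c + 1) * norm (x - d) \<le> (c + 1) * e"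
      using c d(2) by (intro mult_left_mono) auto
    ultimately have fx: "c / 2 * norm x \<le> \<bar>f x\<bar>"
      using f(3) e(2) by (simp add: blinfun.diff_right algebra_simps)
    moreover have "0 < c / 2 * norm x"
      using c False by simp
    ultimately have nf: "f \<noteq> 0" by auto
    have "\<bar>f x\<bar> \<le> \<bar>sgn f x\<bar>"
      using f(2) nf mult_left_mono[OF f(2), of "\<bar>f x\<bar>"]
      by (simp add: sgn_div_norm blinfun.scaleR_left abs_mult field_simps)
    with fx nf f(1) show ?thesis
      by (intro bexI[of _ "sgn f"]) (auto simp: norm_sgn sgn_div_norm intro: subspace_scale[OF M])
  qed
  then obtain g where "g \<in> M" "norm g = 1" "c / 2 * norm x \<le> \<bar>blinfun_apply g x\<bar>"
    by blast
  then show "ereal (c / 2 * norm x) \<le> (SUP f\<in>{f \<in> M. norm f = 1}. ereal \<bar>blinfun_apply f x\<bar>)"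
    by (intro SUP_upper2[of g]) auto
qed

section \<open>Total subspaces with weakly compact ball\<close>

text \<open>
  The successive approximation of the open mapping theorem: repeated approximation with error
  \<open>1/2\<close> writes \<open>x\<close> as a series of vectors of norm at most \<open>1, 1/2, 1/4, ...\<close>, up to a vector on which
  all of \<open>M\<close> vanishes; that vector is \<open>0\<close> because \<open>M\<close> is total.
\<close>

lemma norm_le_of_compact_ball:
  fixes M :: "('a::banach \<Rightarrow>\<^sub>L real) set"
  assumes M: "subspace M" and tot: "total_set M"
    and comp: "compactin weak_topology {f \<in> M. norm f \<le> 1}"
    and x: "\<And>f. f \<in> M \<Longrightarrow> \<bar>blinfun_apply f x\<bar> \<le> norm f"
  shows "norm x \<le> 2"
proof -
  let ?P = "\<lambda>n r. \<forall>f\<in>M. \<bar>blinfun_apply f r\<bar> \<le> (1/2)^n * norm f"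
  have step: "\<exists>r'. ?P (Suc n) r' \<and> norm (r - r') \<le> (1/2)^n" if r: "?P n r" for n r
  proof -
    have "\<bar>blinfun_apply f (2^n *\<^sub>R r)\<bar> \<le> norm f" if "f \<in> M" for f
      using r[rule_format, OF that] by (simp add: blinfun.scaleR_right abs_mult field_simps)
    from approximate_by_unit_ball[OF M comp this, of "1/2"]
    obtain y where y: "norm y \<le> 1" "\<forall>f\<in>M. \<bar>blinfun_apply f (2^n *\<^sub>R r - y)\<bar> \<le> 1/2 * norm f"
      by auto
    let ?r = "r - (1/2)^n *\<^sub>R y"
    have "\<bar>blinfun_apply f ?r\<bar> \<le> (1/2)^Suc n * norm f" if "f \<in> M" for f
    proof -
      have "?r = (1/2)^n *\<^sub>R (2^n *\<^sub>R r - y)"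
        by (simp add: scaleR_diff_right power_divide)
      then have "\<bar>blinfun_apply f ?r\<bar> = (1/2)^n * \<bar>blinfun_apply f (2^n *\<^sub>R r - y)\<bar>"
        by (simp only: blinfun.scaleR_right) (simp add: abs_mult)
      also have "\<dots> \<le> (1/2)^n * (1/2 * norm f)"
        using y(2) that by (intro mult_left_mono) auto
      finally show ?thesis by simp
    qed
    moreover have "norm (r - ?r) \<le> (1/2)^n"
      using y(1) by (simp add: field_simps)
    ultimately show ?thesis by blast
  qed
  \<comment> \<open>The remainders of the successive approximations.\<close>
  have "\<exists>r. \<forall>n. ?P n (r n) \<and> (n = 0 \<longrightarrow> r n = x) \<and> norm (r n - r (Suc n)) \<le> (1/2)^n"
  proof -
    have "\<exists>r. \<forall>n. (?P n (r n) \<and> (n = 0 \<longrightarrow> r n = x)) \<and> norm (r n - r (Suc n)) \<le> (1/2)^n"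
    proof (rule dependent_nat_choice)
      show "\<exists>r. ?P 0 r \<and> (0 = 0 \<longrightarrow> r = x)"
        using x by auto
    next
      fix r n assume "?P n r \<and> (n = 0 \<longrightarrow> r = x)"
      then obtain r' where "?P (Suc n) r'" "norm (r - r') \<le> (1/2)^n"
        using step by blast
      then show "\<exists>r'. (?P (Suc n) r' \<and> (Suc n = 0 \<longrightarrow> r' = x)) \<and> norm (r - r') \<le> (1/2)^n"
        by blast
    qed
    then show ?thesis by blast
  qed
  then obtain r where r: "\<And>n. ?P n (r n)" "r 0 = x" "\<And>n. norm (r n - r (Suc n)) \<le> (1/2)^n"
    by blast
  have geo: "(\<lambda>n. (1/2)^n) sums (2::real)"
    using geometric_sums[of "1/2::real"] by simp
  have summ: "summable (\<lambda>n. norm (r n - r (Suc n)))"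
    by (rule summable_comparison_test'[OF sums_summable[OF geo], where N = 0]) (simp add: r(3))
  have "(\<lambda>n. \<Sum>i<n. r i - r (Suc i)) \<longlonglongrightarrow> (\<Sum>i. r i - r (Suc i))"
    using summable_LIMSEQ[OF summable_norm_cancel[OF summ]] .
  then have "(\<lambda>n. x - r n) \<longlonglongrightarrow> (\<Sum>i. r i - r (Suc i))"
    by (simp add: sum_lessThan_telescope' r(2))
  then have lim: "r \<longlonglongrightarrow> x - (\<Sum>i. r i - r (Suc i))"
    using tendsto_diff[OF tendsto_const[of x], of "\<lambda>n. x - r n"] by simp
  have "blinfun_apply f (x - (\<Sum>i. r i - r (Suc i))) = 0" if f: "f \<in> M" for f
  proof -
    have "(\<lambda>n. (1/2)^n * norm f) \<longlonglongrightarrow> 0"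
      by (intro tendsto_mult_left_zero LIMSEQ_realpow_zero) auto
    then have "(\<lambda>n. blinfun_apply f (r n)) \<longlonglongrightarrow> 0"
      by (rule Lim_null_comparison[rotated]) (use r(1) f in simp)
    moreover have "(\<lambda>n. blinfun_apply f (r n)) \<longlonglongrightarrow> f (x - (\<Sum>i. r i - r (Suc i)))"
      by (intro blinfun.tendsto tendsto_const lim)
    ultimately show ?thesis
      using LIMSEQ_unique by blast
  qed
  then have "x = (\<Sum>i. r i - r (Suc i))"
    using tot unfolding total_set_def by (metis right_minus_eq)
  also have "norm \<dots> \<le> (\<Sum>i. norm (r i - r (Suc i)))"
    by (rule summable_norm[OF summ])
  also have "\<dots> \<le> (\<Sum>i. (1/2)^i)"
    by (rule suminf_le[OF r(3) summ sums_summable[OF geo]])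
  also have "\<dots> = 2"
    using geo by (simp add: sums_iff)
  finally show ?thesis .
qed

lemma norming_over_UNIV_of_compact_ball:
  fixes M :: "('a::banach \<Rightarrow>\<^sub>L real) set"
  assumes M: "subspace M" and tot: "total_set M" and f0: "f0 \<in> M" "f0 \<noteq> 0"
    and comp: "compactin weak_topology {f \<in> M. norm f \<le> 1}"
  shows "norming_over M UNIV"
proof -
  have "\<exists>f\<in>M. norm f \<le> 1 \<and> 1/3 * norm x \<le> \<bar>blinfun_apply f x\<bar>" for x
  proof (rule ccontr)
    assume "\<not> ?thesis"
    then have small: "\<bar>blinfun_apply f x\<bar> < 1/3 * norm x" if "f \<in> M" "norm f \<le> 1" for f
      using that by (meson not_le)
    then have x: "0 < norm x"
      using small[OF subspace_0[OF M]] by simp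
    have "\<bar>blinfun_apply f ((3 / norm x) *\<^sub>R x)\<bar> \<le> norm f" if "f \<in> M" for f
    proof (cases "f = 0")
      case False
      then have "\<bar>blinfun_apply (sgn f) x\<bar> < 1/3 * norm x"
        using that by (intro small) (auto simp: norm_sgn sgn_div_norm intro: subspace_scale[OF M])
      with False x show ?thesis
        by (simp add: sgn_div_norm blinfun.scaleR_left blinfun.scaleR_right abs_mult field_simps)
    qed simp
    from norm_le_of_compact_ball[OF M tot comp this] x show False by simp
  qed
  then show ?thesis
    using norming_over_closure[OF M f0, of "1/3" UNIV] by simp
qed

section \<open>Disjointification\<close>

lemma infinite_partition:
  fixes S :: "nat set"
  assumes "infinite S"
  obtains A :: "nat \<Rightarrow> nat set" where "\<And>p. infinite (A p)" "\<And>p. A p \<subseteq> S"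
    "\<And>p q. p \<noteq> q \<Longrightarrow> A p \<inter> A q = {}"
proof -
  define e where "e p i = enumerate S (prod_encode (p, i))" for p i
  have inj: "e p i = e q j \<longleftrightarrow> p = q \<and> i = j" for p q i j
    using strict_mono_enumerate[OF assms] unfolding e_def by (simp add: strict_mono_eq)
  show thesis
  proof (rule that[of "\<lambda>p. range (e p)"])
    show "infinite (range (e p))" for p
      by (rule range_inj_infinite) (auto simp: inj_def inj)
    show "range (e p) \<subseteq> S" for p
      unfolding e_def using enumerate_in_set[OF assms] by auto
    show "range (e p) \<inter> range (e q) = {}" if "p \<noteq> q" for p q
      using that inj by auto
  qed
qed

text \<open>
  Rosenthal's lemma, with finite sums. Cut \<open>S\<close> into infinitely many infinite pieces. If no piece is as
  required, each piece contains a row index \<open>k p\<close> with mass at least \<open>\<epsilon>\<close> in that piece away from the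
  diagonal. On the set of these indices that mass is lost, so the row bound drops by \<open>\<epsilon>\<close>; this can
  happen only \<open>n\<close> times.
\<close>

lemma Rosenthal_disjointification:
  fixes a :: "nat \<Rightarrow> nat \<Rightarrow> real"
  assumes "infinite S" "0 < \<epsilon>" "\<And>k j. 0 \<le> a k j"
    and "\<And>k F. k \<in> S \<Longrightarrow> finite F \<Longrightarrow> F \<subseteq> S \<Longrightarrow> (\<Sum>j\<in>F. a k j) \<le> real n * \<epsilon>"
  shows "\<exists>T\<subseteq>S. infinite T \<and> (\<forall>k\<in>T. \<forall>F. finite F \<longrightarrow> F \<subseteq> T \<longrightarrow> k \<notin> F \<longrightarrow> (\<Sum>j\<in>F. a k j) < \<epsilon>)"
  using assms(1,4)
proof (induction n arbitrary: S)
  case 0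
  have "(\<Sum>j\<in>F. a k j) < \<epsilon>" if "k \<in> S" "finite F" "F \<subseteq> S" for k F
    using 0(2)[OF that] assms(2) by simp
  with 0(1) show ?case by blast
next
  case (Suc n)
  obtain A :: "nat \<Rightarrow> nat set" where A: "\<And>p. infinite (A p)" "\<And>p. A p \<subseteq> S" "\<And>p q. p \<noteq> q \<Longrightarrow> A p \<inter> A q = {}"
    using infinite_partition[OF Suc.prems(1)] by blast
  let ?good = "\<lambda>T. \<forall>k\<in>T. \<forall>F. finite F \<longrightarrow> F \<subseteq> T \<longrightarrow> k \<notin> F \<longrightarrow> (\<Sum>j\<in>F. a k j) < \<epsilon>"
  show ?case
  proof (cases "\<exists>p. ?good (A p)")
    case True
    then obtain p where "?good (A p)" ..
    with A(1,2)[of p] show ?thesis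
      by (intro exI[of _ "A p"] conjI)
  next
    case False
    then have "\<forall>p. \<exists>k F. k \<in> A p \<and> finite F \<and> F \<subseteq> A p \<and> k \<notin> F \<and> \<epsilon> \<le> (\<Sum>j\<in>F. a k j)"
      by (meson not_less)
    then obtain k F where kF: "\<And>p. k p \<in> A p" "\<And>p. finite (F p)" "\<And>p. F p \<subseteq> A p" "\<And>p. k p \<notin> F p"
      "\<And>p. \<epsilon> \<le> (\<Sum>j\<in>F p. a (k p) j)"
      by metis
    have "inj k"
      using kF(1) A(3) by (metis disjoint_iff injI)
    have row: "(\<Sum>j\<in>G. a i j) \<le> real n * \<epsilon>" if G: "i \<in> range k" "finite G" "G \<subseteq> range k" for i G
    proof -
      obtain p where p: "i = k p" using G(1) by blast
      have disj: "G \<inter> F p = {}"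
      proof (rule ccontr)
        assume "G \<inter> F p \<noteq> {}"
        then obtain q where "k q \<in> F p" using G(3) by blast
        then show False
          using kF A(3) by (metis disjoint_iff subsetD)
      qed
      have "(\<Sum>j\<in>G \<union> F p. a i j) \<le> real (Suc n) * \<epsilon>"
        using G kF(1,2,3) A(2) p by (intro Suc.prems(2)) blast+
      then show ?thesis
        using kF(5)[of p] p by (simp add: sum.union_disjoint[OF G(2) kF(2) disj] algebra_simps)
    qed
    have "\<exists>T\<subseteq>range k. infinite T \<and> ?good T"
      using row \<open>inj k\<close> by (intro Suc.IH) (auto simp: range_inj_infinite)
    then obtain T where T: "T \<subseteq> range k" "infinite T" "?good T"
      by (elim exE conjE)
    have "T \<subseteq> S"
      using T(1) kF(1) A(2) by blast
    with T(2,3) show ?thesis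
      by (intro exI[of _ T] conjI)
  qed
qed

section \<open>Weakly unconditionally convergent series\<close>

text \<open>
  Uniform boundedness: the dual is the union of the closed sets \<open>T m\<close> on which the sums are at most
  \<open>m\<close>, so by Baire some \<open>T m\<close> contains a ball.
\<close>

lemma wuc_uniform_bound:
  fixes x :: "nat \<Rightarrow> 'a::real_normed_vector"
  assumes wuc: "weakly_unconditionally_convergent x"
  obtains C where "0 < C" "\<And>f F. finite F \<Longrightarrow> (\<Sum>n\<in>F. \<bar>blinfun_apply f (x n)\<bar>) \<le> C * norm f"
proof -
  define T where "T m = {f :: 'a \<Rightarrow>\<^sub>L real. \<forall>F. finite F \<longrightarrow> (\<Sum>n\<in>F. \<bar>f (x n)\<bar>) \<le> real m}" for m :: nat
  have closed: "closed (T m)" for m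
    unfolding T_def by (intro closed_Collect_all closed_Collect_imp open_Collect_const closed_Collect_le
        continuous_intros)
  have "f \<in> (\<Union>m. T m)" for f
  proof -
    obtain m :: nat where "(\<Sum>n. \<bar>f (x n)\<bar>) \<le> real m"
      using real_arch_simple by blast
    moreover have "(\<Sum>n\<in>F. \<bar>f (x n)\<bar>) \<le> (\<Sum>n. \<bar>f (x n)\<bar>)" if "finite F" for F
      using wuc that unfolding weakly_unconditionally_convergent_def by (intro sum_le_suminf) auto
    ultimately have "f \<in> T m"
      unfolding T_def using order_trans by blast
    then show ?thesis by blast
  qed
  then have "\<Union>(range T) = UNIV" by blast
  have "\<exists>m. interior (T m) \<noteq> {}"
  proof (rule ccontr)
    assume "\<not> ?thesis"
    then have "euclidean interior_of \<Union>(range T) = {}"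
      using closed completely_metrizable_space_euclidean
      by (intro Baire_category_alt) auto
    with \<open>\<Union>(range T) = UNIV\<close> show False by simp
  qed
  then obtain m f0 where "f0 \<in> interior (T m)" by blast
  then obtain r where r: "0 < r" "ball f0 r \<subseteq> T m"
    unfolding mem_interior by blast
  have sum_T: "(\<Sum>n\<in>F. \<bar>f (x n)\<bar>) \<le> real m" if "f \<in> ball f0 r" "finite F" for f F
    using that r(2) unfolding T_def by blast
  show thesis
  proof (rule that[of "4 * (real m + 1) / r"])
    show "0 < 4 * (real m + 1) / r" using r(1) by simp
    fix f :: "'a \<Rightarrow>\<^sub>L real" and F :: "nat set" assume F: "finite F"
    show "(\<Sum>n\<in>F. \<bar>f (x n)\<bar>) \<le> 4 * (real m + 1) / r * norm f"
    proof (cases "f = 0")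
      case False
      define t where "t = r / (2 * norm f)"
      have t: "0 < t" "norm (t *\<^sub>R f) < r"
        using r(1) False unfolding t_def by auto
      have "t * (\<Sum>n\<in>F. \<bar>f (x n)\<bar>) = (\<Sum>n\<in>F. \<bar>(f0 + t *\<^sub>R f) (x n) - f0 (x n)\<bar>)"
        using t(1) by (simp add: blinfun.add_left blinfun.scaleR_left abs_mult sum_distrib_left)
      also have "\<dots> \<le> (\<Sum>n\<in>F. \<bar>(f0 + t *\<^sub>R f) (x n)\<bar> + \<bar>f0 (x n)\<bar>)"
        by (intro sum_mono abs_triangle_ineq4)
      also have "\<dots> \<le> real m + real m"
        unfolding sum.distrib using t(2) r(1) F
        by (intro add_mono sum_T) (auto simp: dist_norm)
      also have "\<dots> \<le> 2 * (real m + 1)" by simp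
      finally show ?thesis
        using r(1) False unfolding t_def by (simp add: field_simps)
    qed simp
  qed
qed

lemma wuc_norm_sum_le:
  fixes x :: "nat \<Rightarrow> 'a::real_normed_vector"
  assumes C: "\<And>f. (\<Sum>n\<in>F. \<bar>blinfun_apply f (x n)\<bar>) \<le> C * norm f" "0 < C"
    and a: "\<And>n. n \<in> F \<Longrightarrow> \<bar>a n\<bar> \<le> A" and A: "0 \<le> A"
  shows "norm (\<Sum>n\<in>F. a n *\<^sub>R x n) \<le> C * A"
proof -
  obtain f :: "'a \<Rightarrow>\<^sub>L real" where f: "norm f \<le> 1" "f (\<Sum>n\<in>F. a n *\<^sub>R x n) = norm (\<Sum>n\<in>F. a n *\<^sub>R x n)"
    using norming_functional by blast
  have "f (\<Sum>n\<in>F. a n *\<^sub>R x n) = (\<Sum>n\<in>F. a n * f (x n))"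
    by (simp add: blinfun.sum_right blinfun.scaleR_right)
  also have "\<dots> \<le> (\<Sum>n\<in>F. A * \<bar>f (x n)\<bar>)"
  proof (rule sum_mono)
    fix n assume "n \<in> F"
    have "a n * f (x n) \<le> \<bar>a n\<bar> * \<bar>f (x n)\<bar>"
      by (simp flip: abs_mult)
    also have "\<dots> \<le> A * \<bar>f (x n)\<bar>"
      using a[OF \<open>n \<in> F\<close>] by (intro mult_right_mono) auto
    finally show "a n * f (x n) \<le> A * \<bar>f (x n)\<bar>" .
  qed
  also have "\<dots> \<le> A * (C * norm f)"
    unfolding sum_distrib_left[symmetric] using C(1) A by (intro mult_left_mono)
  also have "\<dots> \<le> A * (C * 1)"
    using f(1) A C(2) by (intro mult_left_mono) auto
  finally show ?thesis using f(2) by (simp add: mult.commute)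
qed

text \<open>
  Test the sum with the functional belonging to the largest coefficient: the diagonal term dominates
  the rest by a factor of two.
\<close>

lemma almost_biorthogonal_estimate:
  fixes x :: "nat \<Rightarrow> 'a::real_normed_vector" and f :: "nat \<Rightarrow> 'a \<Rightarrow>\<^sub>L real"
  assumes F: "finite F" "F \<noteq> {}"
    and diag: "\<And>k. k \<in> F \<Longrightarrow> \<delta> < f k (x k)"
    and off: "\<And>k. k \<in> F \<Longrightarrow> (\<Sum>j\<in>F - {k}. \<bar>f k (x j)\<bar>) \<le> \<delta> / 2"
  obtains k where "k \<in> F" "\<And>j. j \<in> F \<Longrightarrow> \<bar>a j\<bar> \<le> \<bar>a k\<bar>"
    "\<delta> / 2 * \<bar>a k\<bar> \<le> \<bar>f k (\<Sum>j\<in>F. a j *\<^sub>R x j)\<bar>"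
proof -
  define A where "A = Max ((\<lambda>j. \<bar>a j\<bar>) ` F)"
  have "A \<in> (\<lambda>j. \<bar>a j\<bar>) ` F"
    unfolding A_def using F by (intro Max_in) auto
  then obtain k where k: "k \<in> F" "\<bar>a k\<bar> = A" by auto
  have max: "\<bar>a j\<bar> \<le> \<bar>a k\<bar>" if "j \<in> F" for j
    unfolding k(2) A_def using F that by (intro Max_ge) auto
  have split: "f k (\<Sum>j\<in>F. a j *\<^sub>R x j) = a k * f k (x k) + (\<Sum>j\<in>F - {k}. a j * f k (x j))"
    by (simp add: blinfun.add_right blinfun.sum_right blinfun.scaleR_right sum.remove[OF F(1) k(1)])
  have "\<bar>\<Sum>j\<in>F - {k}. a j * f k (x j)\<bar> \<le> (\<Sum>j\<in>F - {k}. \<bar>a k\<bar> * \<bar>f k (x j)\<bar>)"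
    using max by (intro order_trans[OF sum_abs] sum_mono) (auto simp: abs_mult intro: mult_right_mono)
  also have "\<dots> \<le> \<bar>a k\<bar> * (\<delta> / 2)"
    unfolding sum_distrib_left[symmetric] using off[OF k(1)] by (intro mult_left_mono) auto
  finally have tail: "\<bar>\<Sum>j\<in>F - {k}. a j * f k (x j)\<bar> \<le> \<bar>a k\<bar> * (\<delta> / 2)" .
  have "\<bar>a k\<bar> * \<delta> \<le> \<bar>a k\<bar> * \<bar>f k (x k)\<bar>"
    using diag[OF k(1)] by (intro mult_left_mono) auto
  then have "\<bar>a k\<bar> * \<delta> \<le> \<bar>a k * f k (x k)\<bar>"
    by (simp add: abs_mult)
  moreover have "\<bar>a k * f k (x k)\<bar> - \<bar>\<Sum>j\<in>F - {k}. a j * f k (x j)\<bar> \<le> \<bar>f k (\<Sum>j\<in>F. a j *\<^sub>R x j)\<bar>"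
    unfolding split using abs_triangle_ineq2[of "a k * f k (x k)" "- (\<Sum>j\<in>F - {k}. a j * f k (x j))"] by simp
  ultimately have "\<delta> / 2 * \<bar>a k\<bar> \<le> \<bar>f k (\<Sum>j\<in>F. a j *\<^sub>R x j)\<bar>"
    using tail by (simp add: algebra_simps)
  with k(1) max show thesis by (rule that)
qed

lemma span_image_cases:
  assumes "v \<in> span (x ` T)"
  obtains F a where "finite F" "F \<subseteq> T" "v = (\<Sum>j\<in>F. a j *\<^sub>R x j)"
proof -
  obtain V r where V: "finite V" "V \<subseteq> x ` T" "v = (\<Sum>b\<in>V. r b *\<^sub>R b)"
    using assms unfolding span_explicit by blast
  then obtain F where F: "F \<subseteq> T" "inj_on x F" "V = x ` F" "finite F"
    unfolding subset_image_inj using finite_image_iff by blast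
  show thesis
  proof (rule that[OF F(4,1)])
    show "v = (\<Sum>j\<in>F. r (x j) *\<^sub>R x j)"
      unfolding V(3) F(3) by (rule sum.reindex_cong[OF F(2)]) auto
  qed
qed

text \<open>
  In a vanishing linear combination the preceding estimate makes the largest coefficient zero, so the
  vectors \<open>x k\<close> are independent.
\<close>

lemma infinite_dimensional_of_almost_biorthogonal:
  fixes x :: "nat \<Rightarrow> 'a::real_normed_vector" and f :: "nat \<Rightarrow> 'a \<Rightarrow>\<^sub>L real"
  assumes T: "infinite T" and \<delta>: "0 < \<delta>"
    and diag: "\<And>k. k \<in> T \<Longrightarrow> \<delta> < f k (x k)"
    and off: "\<And>k F. k \<in> T \<Longrightarrow> finite F \<Longrightarrow> F \<subseteq> T \<Longrightarrow> k \<notin> F \<Longrightarrow> (\<Sum>j\<in>F. \<bar>f k (x j)\<bar>) \<le> \<delta> / 2"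
    and L: "x ` T \<subseteq> L"
  shows "infinite_dimensional L"
proof -
  have inj: "inj_on x T"
  proof (rule inj_onI, rule ccontr)
    fix j k assume "j \<in> T" "k \<in> T" "x j = x k" "j \<noteq> k"
    then show False
      using diag[of k] off[of k "{j}"] \<delta> by auto
  qed
  have "independent (x ` T)"
    unfolding independent_explicit_finite_subsets
  proof (intro allI impI ballI)
    fix V u v assume V: "V \<subseteq> x ` T" "finite V" "(\<Sum>v\<in>V. u v *\<^sub>R v) = 0" and v: "v \<in> V"
    obtain F where F: "F \<subseteq> T" "finite F" "V = x ` F" "inj_on x F"
      using V(1,2) unfolding subset_image_inj using finite_image_iff by blast
    have "F \<noteq> {}" using v F(3) by blast
    have zero: "(\<Sum>j\<in>F. u (x j) *\<^sub>R x j) = 0"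
      using V(3) unfolding F(3) by (simp add: sum.reindex[OF F(4)])
    obtain k where k: "k \<in> F" "\<And>j. j \<in> F \<Longrightarrow> \<bar>u (x j)\<bar> \<le> \<bar>u (x k)\<bar>"
      "\<delta> / 2 * \<bar>u (x k)\<bar> \<le> \<bar>f k (\<Sum>j\<in>F. u (x j) *\<^sub>R x j)\<bar>"
    proof (rule almost_biorthogonal_estimate[OF F(2) \<open>F \<noteq> {}\<close>, of \<delta> f x "\<lambda>j. u (x j)"])
      show "\<delta> < f k (x k)" if "k \<in> F" for k
        using diag F(1) that by blast
      show "(\<Sum>j\<in>F - {k}. \<bar>f k (x j)\<bar>) \<le> \<delta> / 2" if "k \<in> F" for k
        using F(1,2) that by (intro off) auto
    qed (rule that)
    then have "u (x k) = 0"
      using \<delta> unfolding zero by (simp add: mult_le_0_iff blinfun.zero_right)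
    with k(2) v F(3) show "u v = 0" by fastforce
  qed
  moreover have "infinite (x ` T)"
    using T inj finite_imageD by blast
  ultimately show ?thesis
    using independent_span_bound[of _ "x ` T"] L unfolding infinite_dimensional_def by metis
qed

lemma subspace_closure:
  fixes S :: "'a::real_normed_vector set"
  assumes S: "subspace S"
  shows "subspace (closure S)"
proof (rule subspaceI)
  show "0 \<in> closure S"
    using subspace_0[OF S] closure_subset by blast
  fix x y assume "x \<in> closure S" "y \<in> closure S"
  then obtain u v where u: "\<And>n. u n \<in> S" "u \<longlonglongrightarrow> x" and v: "\<And>n. v n \<in> S" "v \<longlonglongrightarrow> y"
    unfolding closure_sequential by blast
  have "(\<lambda>n. u n + v n) \<longlonglongrightarrow> x + y"
    using u(2) v(2) by (rule tendsto_add)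
  then show "x + y \<in> closure S"
    unfolding closure_sequential using subspace_add[OF S] u(1) v(1)
    by (intro exI[of _ "\<lambda>n. u n + v n"]) auto
  fix c :: real
  have "(\<lambda>n. c *\<^sub>R u n) \<longlonglongrightarrow> c *\<^sub>R x"
    using u(2) by (intro tendsto_intros)
  then show "c *\<^sub>R x \<in> closure S"
    unfolding closure_sequential using subspace_scale[OF S] u(1)
    by (intro exI[of _ "\<lambda>n. c *\<^sub>R u n"]) auto
qed

text \<open>
  Pick \<open>f n\<close> in the ball of \<open>M\<close> with \<open>\<delta> < f n (x n)\<close>. The rows of the matrix \<open>f k (x j)\<close> have
  bounded sums, so Rosenthal's lemma gives an infinite \<open>T\<close> on which the off-diagonal mass is below
  \<open>\<delta> / 2\<close>. For combinations of the \<open>x j\<close>, \<open>j \<in> T\<close>, the functionals \<open>f k\<close> bound the maximal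
  coefficient from below and weak unconditional convergence bounds the norm by it from above (these
  vectors span a copy of \<open>c\<^sub>0\<close>), so \<open>M\<close> is norming over their closed span.
\<close>

lemma norming_over_some_of_wuc:
  fixes M :: "('a::banach \<Rightarrow>\<^sub>L real) set"
  assumes M: "subspace M" and f0: "f0 \<in> M" "f0 \<noteq> 0"
    and wuc: "weakly_unconditionally_convergent x"
    and pos: "(INF n. SUP f\<in>{f \<in> M. norm f \<le> 1}. ereal (blinfun_apply f (x n))) > 0"
  shows "\<exists>L. closed_subspace L \<and> infinite_dimensional L \<and> norming_over M L"
proof -
  obtain \<delta> where \<delta>: "0 < ereal \<delta>"
    "ereal \<delta> < (INF n. SUP f\<in>{f \<in> M. norm f \<le> 1}. ereal (blinfun_apply f (x n)))"
    using ereal_dense2[OF pos] by blast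
  have "\<exists>f\<in>{f \<in> M. norm f \<le> 1}. \<delta> < blinfun_apply f (x n)" for n
    using less_INF_D[OF \<delta>(2), of n] by (auto simp: less_SUP_iff)
  then obtain f where f: "\<And>n. f n \<in> M" "\<And>n. norm (f n) \<le> 1" "\<And>n. \<delta> < blinfun_apply (f n) (x n)"
    by simp metis
  have \<delta>0: "0 < \<delta>" using \<delta>(1) by simp
  obtain C where C: "0 < C" "\<And>g F. finite F \<Longrightarrow> (\<Sum>n\<in>F. \<bar>blinfun_apply g (x n)\<bar>) \<le> C * norm g"
    using wuc_uniform_bound[OF wuc] by blast
  obtain N :: nat where N: "C / (\<delta> / 2) \<le> real N"
    using real_arch_simple by blast
  have row: "(\<Sum>j\<in>F. \<bar>f k (x j)\<bar>) \<le> real N * (\<delta> / 2)" if "finite F" for k F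
  proof -
    have "(\<Sum>j\<in>F. \<bar>f k (x j)\<bar>) \<le> C * 1"
      using C(2)[OF that, of "f k"] mult_left_mono[OF f(2)[of k], of C] C(1) by linarith
    with N \<delta>0 show ?thesis by (simp add: field_simps)
  qed
  obtain T where T: "infinite T" "\<And>k F. k \<in> T \<Longrightarrow> finite F \<Longrightarrow> F \<subseteq> T \<Longrightarrow> k \<notin> F \<Longrightarrow>
      (\<Sum>j\<in>F. \<bar>f k (x j)\<bar>) < \<delta> / 2"
    using Rosenthal_disjointification[of UNIV "\<delta> / 2" "\<lambda>k j. \<bar>f k (x j)\<bar>" N] row \<delta>0 by auto
  let ?c = "\<delta> / 2 / C"
  have "\<exists>g\<in>M. norm g \<le> 1 \<and> ?c * norm v \<le> \<bar>blinfun_apply g v\<bar>" if "v \<in> span (x ` T)" for v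
  proof -
    obtain F a where F: "finite F" "F \<subseteq> T" and v: "v = (\<Sum>j\<in>F. a j *\<^sub>R x j)"
      using span_image_cases[OF \<open>v \<in> span (x ` T)\<close>] by blast
    show ?thesis
    proof (cases "F = {}")
      case True
      with v f(1,2) show ?thesis by (intro bexI[of _ "f 0"]) auto
    next
      case False
      obtain k where k: "k \<in> F" "\<And>j. j \<in> F \<Longrightarrow> \<bar>a j\<bar> \<le> \<bar>a k\<bar>" "\<delta> / 2 * \<bar>a k\<bar> \<le> \<bar>f k v\<bar>"
        unfolding v
      proof (rule almost_biorthogonal_estimate[OF F(1) False, of \<delta> f x a])
        show "(\<Sum>j\<in>F - {k}. \<bar>f k (x j)\<bar>) \<le> \<delta> / 2" if "k \<in> F" for k
          using F that by (intro less_imp_le T(2)) auto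
      qed (use f(3) in auto)
      have "norm v \<le> C * \<bar>a k\<bar>"
        unfolding v using C F(1) k(2) by (intro wuc_norm_sum_le) auto
      then have "?c * norm v \<le> ?c * (C * \<bar>a k\<bar>)"
        using C(1) \<delta>0 by (intro mult_left_mono) auto
      with C(1) k(3) have "?c * norm v \<le> \<bar>f k v\<bar>" by simp
      with f(1,2) show ?thesis by blast
    qed
  qed
  then have "norming_over M (closure (span (x ` T)))"
    using C(1) \<delta>0 by (intro norming_over_closure[OF M f0, of ?c]) auto
  moreover have "closed_subspace (closure (span (x ` T)))"
    unfolding closed_subspace_def by (simp add: subspace_closure subspace_span)
  moreover have "x ` T \<subseteq> closure (span (x ` T))"
    using span_superset closure_subset by (meson order_trans)
  then have "infinite_dimensional (closure (span (x ` T)))"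
    using T(2) f(3) less_imp_le
    by (intro infinite_dimensional_of_almost_biorthogonal[OF T(1) \<delta>0, of f x]) blast+
  ultimately show ?thesis by blast
qed

section \<open>Spaces with the Pelczynski property\<close>

theorem mainTheorem4:
  assumes "infinite_dimensional (UNIV :: 'a::banach set)"
    and "Pelczynski_property TYPE('a)"
  shows "\<not> TNNS TYPE('a)"
proof
  assume "TNNS TYPE('a)"
  then obtain M :: "('a \<Rightarrow>\<^sub>L real) set"
    where M: "closed_subspace M" "total_set M" "nowhere_norming M"
    unfolding TNNS_def by blast
  have sM: "subspace M"
    using M(1) unfolding closed_subspace_def by blast
  have "\<exists>x::'a. x \<noteq> 0"
  proof (rule ccontr)
    assume "\<nexists>x::'a. x \<noteq> 0"
    then have "span {} = (UNIV :: 'a set)" by auto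
    with assms(1) show False
      unfolding infinite_dimensional_def by blast
  qed
  then obtain f0 where f0: "f0 \<in> M" "f0 \<noteq> 0"
    using M(2) unfolding total_set_def by (metis blinfun.zero_left)
  have "\<exists>L. closed_subspace L \<and> infinite_dimensional L \<and> norming_over M L"
  proof (cases "relatively_weakly_compact {f \<in> M. norm f \<le> 1}")
    case True
    then have "norming_over M UNIV"
      by (intro norming_over_UNIV_of_compact_ball[OF sM M(2) f0] compactin_weak_subspace_ball[OF M(1)])
    moreover have "closed_subspace (UNIV :: 'a set)"
      unfolding closed_subspace_def by simp
    ultimately show ?thesis
      using assms(1) by blast
  next
    case False
    with assms(2) obtain x :: "nat \<Rightarrow> 'a" where
      "weakly_unconditionally_convergent x"
      "(INF n. SUP f\<in>{f \<in> M. norm f \<le> 1}. ereal (blinfun_apply f (x n))) > 0"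
      unfolding Pelczynski_property_def by blast
    then show ?thesis
      by (rule norming_over_some_of_wuc[OF sM f0])
  qed
  with M(3) show False
    unfolding nowhere_norming_def by blast
qed

end
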